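(* There exists a $B(\kappa)$ such that $U(|\phi|,\kappa)$ is maximized at $|\phi|=B(\kappa)$, and $B(\kappa)$ is decreasing in $\kappa$. There are $\kappa_P$ and $\kappa_L$ such that: (1) community enforcement with optimal community size $B(\kappa)$ results in a higher payoff than pure bilateral enforcement if and only if $\kappa\le\kappa_P$; moreover, whenever $\kappa\le\kappa_P$, $B(\kappa)>B^*$; (2) community enforcement with optimal community size $B(\kappa)$ results in a higher payoff than optimal legal enforcement if and only if $\kappa\le\kappa_L$.
   Context: Parameters: $\alpha\in(0,1]$ (probability a player needs a favor in a period), $p\in(0,1)$ (probability a player is able to provide a favor; favors are substitutable), $v>c>0$ (value and cost of a favor), $\delta\in(0,1)$ (discount factor), $\kappa>0$ (per-period cost of a community link). For a penalty $\gamma\in[0,c)$ for refusing a favor, the cooperation bound $B^*(\gamma)$ is the non-negative integer such that $\delta\alpha v(1-p)^{m-1}p-\delta\alpha c\frac{1-(1-p)^m}{m}\ge(1-\delta)(c-\gamma)$ holds for all positive integers $m\le B^*(\gamma)$ and fails for all $m>B^*(\gamma)$; it is the largest number of links per player that can be supported by bilateral punishments. $B^*=B^*(0)$. Pure bilateral enforcement: $\gamma=0$ and all players have $B^*$ links; the expected per-period payoff is $\alpha(v-c)\big(1-(1-p)^{B^*}\big)$. Legal enforcement: with penalty level $\gamma\ge0$ each player pays $C(\gamma)$ per period, where $C$ is convex, $C(\gamma)>0$ for all $\gamma$ and $\lim_{\gamma\to c}C(\gamma)=\infty$; all players have $B^*(\gamma)$ links, so the per-period payoff is $U(\gamma)=\alpha(v-c)\big(1-(1-p)^{B^*(\gamma)}\big)-C(\gamma)$.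 Optimal legal enforcement uses $\gamma^*=\arg\max_{\gamma\in[0,c]}U(\gamma)$ and gives payoff $U(\gamma^* )$. Community enforcement: $\gamma=0$, each player belongs to a community $\phi$ (a set of players), is linked to all other members of her community, and pays a per-period cost $\kappa$ for each other member. $U(|\phi|,\kappa)$ denotes the expected per-period payoff of a member of a community of size $|\phi|$, including the costs of community links: $U(m+1,\kappa)=\alpha(v-c)\big(1-(1-p)^{m}\big)-m\kappa$.
   Formalization: "Higher payoff" is read as "at least as high" (a tie occurs at a finite threshold), and κ_P, κ_L may be +∞, since if B*=0 or U(γ* )≤0 a one-member community with payoff 0 does at least as well for every κ>0, so no real threshold exists. *)

theory Defs
  imports "HOL-Analysis.Analysis"
begin

definition supports_links ::
  "real \<Rightarrow> real \<Rightarrow> real \<Rightarrow> real \<Rightarrow> real \<Rightarrow> real \<Rightarrow> nat \<Rightarrow> bool" where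
  "supports_links \<alpha> p v c \<delta> \<gamma> m \<longleftrightarrow>
     \<delta> * \<alpha> * v * (1 - p) ^ (m - 1) * p - \<delta> * \<alpha> * c * ((1 - (1 - p) ^ m) / real m)
       \<ge> (1 - \<delta>) * (c - \<gamma>)"

definition coop_bound :: "real \<Rightarrow> real \<Rightarrow> real \<Rightarrow> real \<Rightarrow> real \<Rightarrow> real \<Rightarrow> nat" where
  "coop_bound \<alpha> p v c \<delta> \<gamma> =
     (THE B. (\<forall>m. 1 \<le> m \<and> m \<le> B \<longrightarrow> supports_links \<alpha> p v c \<delta> \<gamma> m) \<and>
             (\<forall>m. B < m \<longrightarrow> \<not> supports_links \<alpha> p v c \<delta> \<gamma> m))"

definition favor_payoff :: "real \<Rightarrow> real \<Rightarrow> real \<Rightarrow> real \<Rightarrow> nat \<Rightarrow> real" where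
  "favor_payoff \<alpha> p v c m = \<alpha> * (v - c) * (1 - (1 - p) ^ m)"

definition bilateral_payoff :: "real \<Rightarrow> real \<Rightarrow> real \<Rightarrow> real \<Rightarrow> real \<Rightarrow> real" where
  "bilateral_payoff \<alpha> p v c \<delta> = favor_payoff \<alpha> p v c (coop_bound \<alpha> p v c \<delta> 0)"

(* The enforcement cost C is finite on [0,c) and tends to infinity at c, so the
   endpoint c of the penalty range [0,c] has cost infinity and payoff minus infinity. *)
definition legal_payoff ::
  "real \<Rightarrow> real \<Rightarrow> real \<Rightarrow> real \<Rightarrow> real \<Rightarrow> (real \<Rightarrow> real) \<Rightarrow> real \<Rightarrow> ereal" where
  "legal_payoff \<alpha> p v c \<delta> C \<gamma> =
     (if \<gamma> < c then ereal (favor_payoff \<alpha> p v c (coop_bound \<alpha> p v c \<delta> \<gamma>) - C \<gamma>) else -\<infinity>)"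

(* The argument n is the community size, counting the player herself: she has n - 1
   links.  Only sizes n \<ge> 1 are meaningful. *)
definition community_payoff :: "real \<Rightarrow> real \<Rightarrow> real \<Rightarrow> real \<Rightarrow> nat \<Rightarrow> real \<Rightarrow> real" where
  "community_payoff \<alpha> p v c n \<kappa> = favor_payoff \<alpha> p v c (n - 1) - real (n - 1) * \<kappa>"

end

theory Submission imports Defs begin

text \<open>With \<open>m\<close> links at cost \<open>\<kappa>\<close> the payoff is \<open>F m - m * \<kappa>\<close> for a bounded
  \<open>F\<close> with \<open>F 0 = 0\<close>. Adding the two optimality conditions at different costs shows that
  every selection of maximizers is decreasing. A target \<open>W > 0\<close> below the supremum of
  \<open>F\<close> is reachable with some \<open>m\<close> iff \<open>\<kappa> \<le> (F m - W) / m\<close> for some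
  \<open>m \<ge> 1\<close>; these quotients attain their maximum, which is the threshold. Both outside
  options are below the supremum \<open>\<alpha> * (v - c)\<close>: bilateral enforcement because its number
  of links is finite, legal enforcement because moreover \<open>C > 0\<close>.\<close>

text \<open>Only finitely many \<open>m\<close> compete: as \<open>F\<close> is bounded by
  \<open>A\<close>, a linear cost of at least \<open>A - F 0\<close> leaves no more than the payoff
  at 0.\<close>

lemma linear_cost_maximizer_exists:
  fixes F :: "nat \<Rightarrow> real"
  assumes "\<And>m. F m \<le> A" "0 < \<kappa>"
  shows "\<exists>m. \<forall>k. F k - real k * \<kappa> \<le> F m - real m * \<kappa>"
proof -
  let ?g = "\<lambda>m. F m - real m * \<kappa>"
  obtain N :: nat where N: "A - F 0 < real N * \<kappa>"
    using reals_Archimedean3[OF assms(2)] by blast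
  have "Max (?g ` {..N}) \<in> ?g ` {..N}"
    by (rule Max_in) auto
  then obtain m where m: "Max (?g ` {..N}) = ?g m" by blast
  have le: "?g k \<le> ?g m" if "k \<le> N" for k
    unfolding m[symmetric] using that by (intro Max_ge) auto
  have "?g k \<le> ?g m" if "N < k" for k
  proof -
    have "real N * \<kappa> \<le> real k * \<kappa>"
      using that assms(2) by (intro mult_right_mono) auto
    then have "?g k \<le> ?g 0"
      using assms(1)[of k] N by simp
    then show ?thesis using le[of 0] by simp
  qed
  then show ?thesis using le by (metis not_le)
qed

text \<open>The values of \<open>F\<close> cancel in the sum of the two inequalities, so no
  monotonicity of \<open>F\<close> is involved. Strictness of \<open>\<kappa> < \<kappa>'\<close>
  matters, since one cost may have several maximizers.\<close>

lemma linear_cost_maximizer_antimono: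
  fixes F :: "nat \<Rightarrow> real"
  assumes "F n - real n * \<kappa> \<le> F m - real m * \<kappa>"
    and "F m - real m * \<kappa>' \<le> F n - real n * \<kappa>'"
    and "\<kappa> < \<kappa>'"
  shows "n \<le> m"
proof -
  have "real n * (\<kappa>' - \<kappa>) \<le> real m * (\<kappa>' - \<kappa>)"
    using assms(1,2) by (simp add: algebra_simps)
  then show ?thesis using assms(3) by simp
qed

text \<open>The threshold is an extended real because a target \<open>W \<le> 0\<close> is met by
  zero links at every cost, which makes it infinite. For \<open>W > 0\<close> the quotients are
  eventually below a fixed positive one, so their supremum is attained and the boundary cost itself
  still reaches \<open>W\<close>.\<close>

lemma linear_cost_threshold:
  fixes F :: "nat \<Rightarrow> real"
  assumes F0: "F 0 = 0" and bdd: "\<And>m. F m \<le> A" and M: "W < F M"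
  shows "\<exists>K::ereal. \<forall>\<kappa>>0. (\<exists>m. W \<le> F m - real m * \<kappa>) \<longleftrightarrow> ereal \<kappa> \<le> K"
proof (cases "W \<le> 0")
  case True
  then have "W \<le> F 0 - real 0 * \<kappa>" for \<kappa>
    using F0 by simp
  then have "\<forall>\<kappa>>0. (\<exists>m. W \<le> F m - real m * \<kappa>) \<longleftrightarrow> ereal \<kappa> \<le> \<infinity>"
    using ereal_less_eq(1) by blast
  then show ?thesis by (rule exI)
next
  case False
  let ?g = "\<lambda>m. (F m - W) / real m"
  have "0 < M" using M F0 False by (cases M) auto
  then have gM: "0 < ?g M" using M by simp
  \<comment> \<open>Beyond this \<open>N\<close> the numerator \<open>F m - W\<close> is below
    \<open>A\<close>, hence below \<open>m * ?g M\<close>, so the quotient at \<open>m\<close>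
    cannot beat the one at \<open>M\<close>.\<close>
  obtain N :: nat where N: "A < real N * ?g M"
    using reals_Archimedean3[OF gM] by blast
  define S where "S = {1..max M N}"
  have S: "finite S" "M \<in> S" using \<open>0 < M\<close> by (auto simp: S_def)
  have "\<exists>k\<in>S. ?g m \<le> ?g k" if "1 \<le> m" for m
  proof (cases "m \<in> S")
    case False
    then have "N < m" using that by (auto simp: S_def)
    then have "real N * ?g M \<le> real m * ?g M"
      using gM by (intro mult_right_mono) auto
    then have "F m - W \<le> real m * ?g M"
      using bdd[of m] N \<open>\<not> W \<le> 0\<close> by linarith
    then have "?g m \<le> ?g M"
      using that by (simp add: pos_divide_le_eq mult.commute)
    then show ?thesis using S by blast
  qed auto
  then have top: "?g m \<le> Max (?g ` S)" if "1 \<le> m" for m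
    using that S by (subst Max_ge_iff) auto
  have "Max (?g ` S) \<in> ?g ` S"
    using S by (intro Max_in) auto
  then obtain k where k: "k \<in> S" "Max (?g ` S) = ?g k" by blast
  have reach: "W \<le> F m - real m * \<kappa> \<longleftrightarrow> \<kappa> \<le> ?g m" if "1 \<le> m" for m \<kappa>
    using that by (auto simp: pos_le_divide_eq algebra_simps)
  have "(\<exists>m. W \<le> F m - real m * \<kappa>) \<longleftrightarrow> ereal \<kappa> \<le> ereal (Max (?g ` S))" for \<kappa>
  proof
    assume "\<exists>m. W \<le> F m - real m * \<kappa>"
    then obtain m where m: "W \<le> F m - real m * \<kappa>" by blast
    \<comment> \<open>Zero links yield payoff 0, which misses a positive target; this also makes the
      division by \<open>m\<close> legitimate.\<close>
    then have "1 \<le> m" using F0 False by (cases m) auto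
    then show "ereal \<kappa> \<le> ereal (Max (?g ` S))"
      using m reach top by fastforce
  next
    assume "ereal \<kappa> \<le> ereal (Max (?g ` S))"
    then have "\<kappa> \<le> ?g k" using k(2) by simp
    moreover have "1 \<le> k" using k(1) by (simp add: S_def)
    ultimately show "\<exists>m. W \<le> F m - real m * \<kappa>"
      using reach by blast
  qed
  then show ?thesis by blast
qed

lemma favor_payoff_0: "favor_payoff \<alpha> p v c 0 = 0"
  by (simp add: favor_payoff_def)

text \<open>The gap \<open>\<alpha> * (v - c) * (1 - p) ^ m\<close> never closes at a finite
  \<open>m\<close>. This strictness is what lets some larger number of links beat any given
  one.\<close>

lemma favor_payoff_less:
  assumes "0 < \<alpha>" "c < v" "p < 1"
  shows "favor_payoff \<alpha> p v c m < \<alpha> * (v - c)"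
proof -
  have "0 < \<alpha> * (v - c)" "0 < (1 - p) ^ m" using assms by auto
  then have "0 < \<alpha> * (v - c) * (1 - p) ^ m" by (rule mult_pos_pos)
  then show ?thesis by (simp add: favor_payoff_def right_diff_distrib)
qed

lemma favor_payoff_mono:
  assumes "0 < \<alpha>" "c < v" "0 < p" "p < 1" "m \<le> n"
  shows "favor_payoff \<alpha> p v c m \<le> favor_payoff \<alpha> p v c n"
  unfolding favor_payoff_def using assms
  by (intro mult_left_mono diff_left_mono power_decreasing) auto

lemma favor_payoff_eventually_greater:
  assumes "0 < p" "p < 1" "W < \<alpha> * (v - c)"
  shows "\<exists>M. W < favor_payoff \<alpha> p v c M"
proof -
  have "(\<lambda>m. favor_payoff \<alpha> p v c m) \<longlonglongrightarrow> \<alpha> * (v - c) * (1 - 0)"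
    unfolding favor_payoff_def using assms(1,2)
    by (intro tendsto_intros LIMSEQ_realpow_zero) auto
  then have "\<forall>\<^sub>F m in sequentially. W < favor_payoff \<alpha> p v c m"
    using assms(3) by (intro order_tendstoD(1)) auto
  then show ?thesis
    by (intro eventually_happens'[OF sequentially_bot])
qed

theorem proposition8:
  fixes \<alpha> p v c \<delta> :: real and C :: "real \<Rightarrow> real"
  assumes "0 < \<alpha>" "\<alpha> \<le> 1"
    and "0 < p" "p < 1"
    and "0 < c" "c < v"
    and "0 < \<delta>" "\<delta> < 1"
    and "convex_on {0..<c} C"
    and "\<And>\<gamma>. \<gamma> \<in> {0..<c} \<Longrightarrow> 0 < C \<gamma>"
    and "filterlim C at_top (at_left c)"
  shows "\<exists>B :: real \<Rightarrow> nat.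
      (\<forall>\<kappa>>0. is_arg_max (\<lambda>n. community_payoff \<alpha> p v c n \<kappa>) (\<lambda>n. 1 \<le> n) (B \<kappa>)) \<and>
      antimono_on {0<..} B \<and>
      (\<exists>\<kappa>\<^sub>P \<kappa>\<^sub>L :: ereal.
        (\<forall>\<kappa>>0. community_payoff \<alpha> p v c (B \<kappa>) \<kappa> \<ge> bilateral_payoff \<alpha> p v c \<delta>
                 \<longleftrightarrow> ereal \<kappa> \<le> \<kappa>\<^sub>P) \<and>
        (\<forall>\<kappa>>0. ereal \<kappa> \<le> \<kappa>\<^sub>P \<longrightarrow> B \<kappa> > coop_bound \<alpha> p v c \<delta> 0) \<and>
        (\<forall>\<gamma>\<^sub>s. is_arg_max (legal_payoff \<alpha> p v c \<delta> C) (\<lambda>\<gamma>. \<gamma> \<in> {0..c}) \<gamma>\<^sub>s \<longrightarrow>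
           (\<forall>\<kappa>>0. ereal (community_payoff \<alpha> p v c (B \<kappa>) \<kappa>) \<ge> legal_payoff \<alpha> p v c \<delta> C \<gamma>\<^sub>s
                    \<longleftrightarrow> ereal \<kappa> \<le> \<kappa>\<^sub>L)))"
proof -
  define F where "F = favor_payoff \<alpha> p v c"
  have F0: "F 0 = 0" by (simp add: F_def favor_payoff_0)
  have F_less: "F m < \<alpha> * (v - c)" for m
    unfolding F_def using assms by (intro favor_payoff_less)
  have bdd: "F m \<le> \<alpha> * (v - c)" for m
    using F_less[of m] by simp
  have community: "community_payoff \<alpha> p v c n \<kappa> = F (n - 1) - real (n - 1) * \<kappa>" for n \<kappa>
    by (simp add: community_payoff_def F_def)

  have "\<exists>m. \<forall>k. F k - real k * \<kappa> \<le> F m - real m * \<kappa>" if "0 < \<kappa>" for \<kappa>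
    using bdd that by (rule linear_cost_maximizer_exists)
  then obtain L where L: "\<And>\<kappa> k. 0 < \<kappa> \<Longrightarrow> F k - real k * \<kappa> \<le> F (L \<kappa>) - real (L \<kappa>) * \<kappa>"
    by metis
  \<comment> \<open>\<open>L\<close> counts links, while a community size also counts the player
    herself.\<close>
  define B where "B = (\<lambda>\<kappa>. Suc (L \<kappa>))"
  have community_B: "community_payoff \<alpha> p v c (B \<kappa>) \<kappa> = F (L \<kappa>) - real (L \<kappa>) * \<kappa>" for \<kappa>
    by (simp add: community B_def)

  have arg_max: "is_arg_max (\<lambda>n. community_payoff \<alpha> p v c n \<kappa>) (\<lambda>n. 1 \<le> n) (B \<kappa>)"
    if "0 < \<kappa>" for \<kappa>
    unfolding is_arg_max_def community_B using L[OF that]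
    by (auto simp: community B_def not_less)
  have "antimono_on {0<..} B"
  proof (rule monotone_onI)
    fix \<kappa> \<kappa>' :: real
    assume "\<kappa> \<in> {0<..}" "\<kappa>' \<in> {0<..}" "\<kappa> \<le> \<kappa>'"
    \<comment> \<open>At equal costs the claim is trivial because \<open>B\<close> is a fixed
      selection.\<close>
    then show "B \<kappa> \<ge> B \<kappa>'"
      using L linear_cost_maximizer_antimono[of F "L \<kappa>'" \<kappa> "L \<kappa>" \<kappa>']
      by (cases "\<kappa> = \<kappa>'") (auto simp: B_def)
  qed

  have threshold: "\<exists>K::ereal. \<forall>\<kappa>>0. W \<le> community_payoff \<alpha> p v c (B \<kappa>) \<kappa> \<longleftrightarrow> ereal \<kappa> \<le> K"
    if W: "W < \<alpha> * (v - c)" for W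
  proof -
    obtain M where "W < F M"
      using favor_payoff_eventually_greater[OF assms(3,4) W] by (auto simp: F_def)
    then obtain K where K: "\<forall>\<kappa>>0. (\<exists>m. W \<le> F m - real m * \<kappa>) \<longleftrightarrow> ereal \<kappa> \<le> K"
      using linear_cost_threshold[where F = F, OF F0 bdd] by blast
    \<comment> \<open>The optimal size reaches \<open>W\<close> exactly when some size does, so the
      threshold for reachability carries over.\<close>
    have "W \<le> community_payoff \<alpha> p v c (B \<kappa>) \<kappa> \<longleftrightarrow> (\<exists>m. W \<le> F m - real m * \<kappa>)" if "0 < \<kappa>" for \<kappa>
    proof
      assume "\<exists>m. W \<le> F m - real m * \<kappa>"
      then show "W \<le> community_payoff \<alpha> p v c (B \<kappa>) \<kappa>"
        unfolding community_B using L[OF that] by (auto intro: order_trans)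
    next
      assume "W \<le> community_payoff \<alpha> p v c (B \<kappa>) \<kappa>"
      then show "\<exists>m. W \<le> F m - real m * \<kappa>"
        unfolding community_B by (rule exI)
    qed
    with K show ?thesis by (intro exI[of _ K]) simp
  qed

  define b where "b = coop_bound \<alpha> p v c \<delta> 0"
  have bilateral: "bilateral_payoff \<alpha> p v c \<delta> = F b"
    by (simp add: bilateral_payoff_def F_def b_def)
  obtain \<kappa>\<^sub>P where P: "\<forall>\<kappa>>0. bilateral_payoff \<alpha> p v c \<delta> \<le> community_payoff \<alpha> p v c (B \<kappa>) \<kappa>
      \<longleftrightarrow> ereal \<kappa> \<le> \<kappa>\<^sub>P"
    using threshold[OF F_less[of b]] unfolding bilateral by blast
  have larger: "b < B \<kappa>" if "0 < \<kappa>" "ereal \<kappa> \<le> \<kappa>\<^sub>P" for \<kappa>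
  proof (rule ccontr)
    assume "\<not> b < B \<kappa>"
    \<comment> \<open>The shift between size and links makes this strict, so \<open>b\<close> is
      positive. Fewer links than \<open>b\<close> earn no more from favors, so matching
      \<open>F b\<close> forces their total cost to 0; then there are no links at all, against
      \<open>0 < F b\<close>.\<close>
    then have "L \<kappa> < b" by (simp add: B_def)
    have reach: "F b \<le> F (L \<kappa>) - real (L \<kappa>) * \<kappa>"
      using P that unfolding bilateral community_B by blast
    have "F (L \<kappa>) \<le> F b"
      unfolding F_def using assms \<open>L \<kappa> < b\<close> by (intro favor_payoff_mono) auto
    then have "real (L \<kappa>) * \<kappa> \<le> 0" using reach by simp
    then have "L \<kappa> = 0" using that(1) by (simp add: mult_le_0_iff)
    then have "F b \<le> 0" using reach F0 by simp
    moreover have "0 < F b"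
    proof -
      have "(1 - p) ^ b < 1"
        using assms \<open>L \<kappa> < b\<close> by (intro power_less_one_iff[THEN iffD2]) auto
      then show ?thesis using assms by (simp add: F_def favor_payoff_def)
    qed
    ultimately show False by simp
  qed

  have "\<exists>\<kappa>\<^sub>L::ereal. \<forall>\<gamma>\<^sub>s. is_arg_max (legal_payoff \<alpha> p v c \<delta> C) (\<lambda>\<gamma>. \<gamma> \<in> {0..c}) \<gamma>\<^sub>s \<longrightarrow>
      (\<forall>\<kappa>>0. ereal (community_payoff \<alpha> p v c (B \<kappa>) \<kappa>) \<ge> legal_payoff \<alpha> p v c \<delta> C \<gamma>\<^sub>s
        \<longleftrightarrow> ereal \<kappa> \<le> \<kappa>\<^sub>L)" (is "\<exists>\<kappa>\<^sub>L. \<forall>\<gamma>\<^sub>s. ?max \<gamma>\<^sub>s \<longrightarrow> ?thr \<kappa>\<^sub>L \<gamma>\<^sub>s")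
  proof (cases "\<exists>\<gamma>. ?max \<gamma>")
    case True
    then obtain \<gamma> where \<gamma>: "?max \<gamma>" by blast
    define W where "W = F (coop_bound \<alpha> p v c \<delta> \<gamma>) - C \<gamma>"
    have "\<gamma> \<in> {0..c}" using \<gamma> by (simp add: is_arg_max_def)
    \<comment> \<open>Comparison with penalty 0, whose payoff is finite, excludes the endpoint
      \<open>c\<close>, whose payoff is minus infinity.\<close>
    have "legal_payoff \<alpha> p v c \<delta> C 0 \<le> legal_payoff \<alpha> p v c \<delta> C \<gamma>"
      using \<gamma> assms by (auto simp: is_arg_max_def not_less)
    then have "\<gamma> < c" using assms by (auto simp: legal_payoff_def split: if_splits)
    then have legal: "legal_payoff \<alpha> p v c \<delta> C \<gamma> = ereal W"
      by (simp add: legal_payoff_def W_def F_def)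
    have "0 < C \<gamma>" using assms(10) \<open>\<gamma> < c\<close> \<open>\<gamma> \<in> {0..c}\<close> by simp
    then have "W < \<alpha> * (v - c)"
      using F_less[of "coop_bound \<alpha> p v c \<delta> \<gamma>"] by (simp add: W_def)
    from threshold[OF this] have "\<exists>K. ?thr K \<gamma>"
      unfolding legal ereal_less_eq .
    then obtain K where "?thr K \<gamma>" by (rule exE)
    \<comment> \<open>All maximizers share one payoff, so the threshold found for
      \<open>\<gamma>\<close> serves every choice of optimal penalty.\<close>
    moreover have "legal_payoff \<alpha> p v c \<delta> C \<gamma>' = legal_payoff \<alpha> p v c \<delta> C \<gamma>" if "?max \<gamma>'" for \<gamma>'
      using that \<gamma> unfolding is_arg_max_def by (intro antisym) (auto simp: not_less)
    ultimately show ?thesis by (intro exI[of _ K]) simp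
  \<comment> \<open>Without an optimal penalty the claim is vacuous and any threshold will
    do.\<close>
  qed blast
  then obtain \<kappa>\<^sub>L where "\<forall>\<gamma>\<^sub>s. ?max \<gamma>\<^sub>s \<longrightarrow> ?thr \<kappa>\<^sub>L \<gamma>\<^sub>s"
    by (rule exE)
  then show ?thesis
    using arg_max \<open>antimono_on {0<..} B\<close> P larger unfolding b_def
    by (intro exI[of _ B] exI[of _ \<kappa>\<^sub>P] exI[of _ \<kappa>\<^sub>L] conjI) simp_all
qed

end
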